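(* For every even integer $g\ge4$ there are infinitely many primitive numbers (with respect to $g$).
   Context: Fix an even integer $g\ge4$. For an odd integer $m\ge1$, an extreme cycle for the digit set $\{0,m\}$ is a finite set of distinct integers $\{x_0,\dots,x_{r-1}\}$ together with digits $l_0,\dots,l_{r-1}\in\{0,m\}$ such that $x_{j+1}=(x_j+l_j)/g$ for $0\le j\le r-2$ and $x_0=(x_{r-1}+l_{r-1})/g$. The cycle $\{0\}$ (with digit $0$) is the trivial extreme cycle. The odd number $m$ is complete if the only extreme cycle for $\{0,m\}$ is the trivial one, and incomplete otherwise. An odd number $m$ is primitive if it is incomplete and every proper divisor $d$ of $m$ is complete. *)

theory Defs
  imports Complex_Main
begin

text \<open>
  The list \<open>xs = [x\<^sub>0, \<dots>, x\<^sub>r\<^sub>-\<^sub>1]\<close> holds the points of the cycle and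
  \<open>ls = [l\<^sub>0, \<dots>, l\<^sub>r\<^sub>-\<^sub>1]\<close> its digits. The quotients are taken in the reals, so each
  equation includes the claim that the quotient is an integer.
\<close>

definition extreme_cycle :: "nat \<Rightarrow> nat \<Rightarrow> int list \<Rightarrow> int list \<Rightarrow> bool" where
  "extreme_cycle g m xs ls \<longleftrightarrow>
     xs \<noteq> [] \<and> distinct xs \<and> length ls = length xs \<and> set ls \<subseteq> {0, int m} \<and>
     (\<forall>j. Suc j < length xs \<longrightarrow>
        real_of_int (xs ! Suc j) = real_of_int (xs ! j + ls ! j) / real g) \<and>
     real_of_int (xs ! 0) =
       real_of_int (xs ! (length xs - 1) + ls ! (length xs - 1)) / real g"

definition complete_number :: "nat \<Rightarrow> nat \<Rightarrow> bool" where
  "complete_number g m \<longleftrightarrow>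
     odd m \<and> (\<forall>xs ls. extreme_cycle g m xs ls \<longrightarrow> xs = [0] \<and> ls = [0])"

definition incomplete_number :: "nat \<Rightarrow> nat \<Rightarrow> bool" where
  "incomplete_number g m \<longleftrightarrow> odd m \<and> \<not> complete_number g m"

definition primitive_number :: "nat \<Rightarrow> nat \<Rightarrow> bool" where
  "primitive_number g m \<longleftrightarrow>
     incomplete_number g m \<and> (\<forall>d. d dvd m \<and> d \<noteq> m \<longrightarrow> complete_number g d)"

end

theory Submission
  imports Defs "HOL-Number_Theory.Residues" "HOL-Library.Infinite_Set"
begin

text \<open>
  An integer \<open>x\<close> lies on an extreme cycle for \<open>{0, m}\<close> when \<open>x / m\<close> has a purely periodic
  base-\<open>g\<close> expansion with digits 0 and 1 only. For the repunit \<open>m = (g\<^sup>r - 1) / (g - 1)\<close> with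
  \<open>r \<ge> g - 1\<close> such a fraction is \<open>(1 + g + \<dots> + g\<^bsup>g-2\<^esup>) / (g\<^sup>r - 1)\<close>, because \<open>g - 1\<close> divides
  the numerator; so \<open>m\<close> is incomplete. By Euler's theorem, if \<open>r - 1 = (g M)!\<close> then \<open>m\<close> is
  congruent to 1 modulo each of its divisors \<open>d \<le> M\<close>, so \<open>d = 1\<close>. As 1 is complete, the least
  incomplete divisor of \<open>m\<close> is a primitive number exceeding \<open>M\<close>.
\<close>

text \<open>Choosing successors inside \<open>S\<close> gives a self-map of a finite set, so some
  orbit becomes periodic. Its periodic part is an extreme cycle, nontrivial because it avoids
  0.\<close>

lemma incomplete_if_closed_set:
  fixes S :: "int set"
  assumes "g > 0" and S: "finite S" "S \<noteq> {}" "0 \<notin> S"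
    and step: "\<And>x. x \<in> S \<Longrightarrow> \<exists>y\<in>S. int g * y - x \<in> {0, int m}"
  shows "\<not> complete_number g m"
proof -
  obtain f where fS: "\<And>x. x \<in> S \<Longrightarrow> f x \<in> S"
    and fl: "\<And>x. x \<in> S \<Longrightarrow> int g * f x - x \<in> {0, int m}"
    using step by metis
  obtain x where "x \<in> S" using S by blast
  then have iter_S: "(f ^^ n) x \<in> S" for n
    by (induction n) (auto intro: fS)
  have "\<not> inj (\<lambda>n. (f ^^ n) x)"
  proof
    assume "inj (\<lambda>n. (f ^^ n) x)"
    then have "infinite (range (\<lambda>n. (f ^^ n) x))" by (simp add: range_inj_infinite)
    moreover have "range (\<lambda>n. (f ^^ n) x) \<subseteq> S" using iter_S by blast
    ultimately show False using S(1) finite_subset by blast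
  qed
  then obtain i j where ij: "i < j" "(f ^^ i) x = (f ^^ j) x"
    unfolding inj_def by (metis nat_neq_iff)
  define y where "y = (f ^^ i) x"
  have "(f ^^ (j - i)) y = y"
    unfolding y_def using ij by (metis funpow_add o_apply le_add_diff_inverse2 less_imp_le)
  then have ex: "\<exists>p>0. (f ^^ p) y = y" using ij by (intro exI[of _ "j - i"]) simp
  \<comment> \<open>The least period is taken because the points of an extreme cycle must be
    distinct.\<close>
  define p where "p = (LEAST p. p > 0 \<and> (f ^^ p) y = y)"
  have p: "p > 0" "(f ^^ p) y = y"
    using LeastI_ex[OF ex] unfolding p_def by auto
  have minimal: "p \<le> q" if "q > 0" "(f ^^ q) y = y" for q
    unfolding p_def using that by (intro Least_le) simp
  have y_S: "(f ^^ n) y \<in> S" for n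
    unfolding y_def using iter_S[of "n + i"] by (simp add: funpow_add)
  have neq: "(f ^^ a) y \<noteq> (f ^^ b) y" if "a < b" "b < p" for a b
  proof
    assume "(f ^^ a) y = (f ^^ b) y"
    \<comment> \<open>Running both sides on to time \<open>p\<close> makes \<open>p - b + a\<close>
      a positive period smaller than \<open>p\<close>.\<close>
    then have "(f ^^ (p - b)) ((f ^^ a) y) = (f ^^ (p - b)) ((f ^^ b) y)" by simp
    then have "(f ^^ (p - b + a)) y = y"
      using p that by (simp flip: funpow_add[unfolded o_def, THEN fun_cong])
    then show False using minimal[of "p - b + a"] that by simp
  qed
  define xs where "xs = map (\<lambda>n. (f ^^ n) y) [0..<p]"
  define ls where "ls = map (\<lambda>x. int g * f x - x) xs"
  have "inj_on (\<lambda>n. (f ^^ n) y) {0..<p}"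
    by (rule linorder_inj_onI) (use neq in auto)
  then have "distinct xs" by (simp add: xs_def distinct_map)
  moreover have "f ((f ^^ (p - 1)) y) = y"
    using p by (metis Suc_diff_1 funpow.simps(2) o_apply)
  moreover have "set ls \<subseteq> {0, int m}"
    unfolding ls_def xs_def set_map image_image using fl[OF y_S] by blast
  ultimately have "extreme_cycle g m xs ls"
    using p(1) \<open>g > 0\<close> unfolding extreme_cycle_def by (auto simp: ls_def xs_def)
  moreover have "xs \<noteq> [0]"
    using y_S[of 0] S(3) p(1) by (auto simp: xs_def upt_conv_Cons)
  ultimately show ?thesis unfolding complete_number_def by blast
qed

text \<open>If \<open>c * x\<close> is the sum over \<open>A\<close>, then \<open>x / m\<close> is
  that sum over \<open>g ^ r - 1\<close>, so its expansion has period \<open>r\<close> and its ones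
  are given by \<open>A\<close>. Passing to the next cycle point rotates the digit block, so the
  integers arising from all nonempty digit sets form a closed set as in
  \<open>incomplete_if_closed_set\<close>.\<close>

lemma incomplete_if_digit_set:
  assumes "g > 0" and m: "int m * c = int g ^ r - 1" and "c > 0"
    and A: "A \<subseteq> {..<r}" "A \<noteq> {}" and dvd: "c dvd (\<Sum>j\<in>A. int g ^ j)"
  shows "\<not> complete_number g m"
proof -
  define N where "N B = (\<Sum>j\<in>B. int g ^ j)" for B
  define S where "S = {x. \<exists>B. B \<subseteq> {..<r} \<and> B \<noteq> {} \<and> c * x = N B}"
  have N_pos: "N B > 0" if "B \<subseteq> {..<r}" "B \<noteq> {}" for B
    unfolding N_def using that \<open>g > 0\<close> by (intro sum_pos) (auto intro: finite_subset)
  have "r > 0" using A by (auto intro!: Nat.gr0I)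
  \<comment> \<open>This later cancels \<open>g\<close>, so that the rotated sum is again divisible
    by \<open>c\<close>.\<close>
  have "coprime c (int g)"
  proof (rule coprimeI)
    fix e assume e: "e dvd c" "e dvd int g"
    then have "e dvd int g ^ r - int m * c" 
      using \<open>r > 0\<close> by (intro dvd_diff dvd_mult) (auto intro: dvd_trans[OF _ dvd_power])
    then show "is_unit e" using m by simp
  qed
  show ?thesis
  proof (rule incomplete_if_closed_set)
    have "x \<in> (\<lambda>B. N B div c) ` Pow {..<r}" if x: "x \<in> S" for x
    proof -
      obtain B where B: "B \<subseteq> {..<r}" "c * x = N B" using x by (auto simp: S_def)
      then have "x = N B div c" using \<open>c > 0\<close> by (metis nonzero_mult_div_cancel_left less_irrefl)
      then show ?thesis using B by blast
    qed
    then show "finite S" by (meson finite_Pow_iff finite_imageI finite_lessThan finite_subset subsetI)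
    obtain x where "c * x = N A" using dvd by (metis N_def dvdE)
    then show "S \<noteq> {}" using A by (auto simp: S_def)
    show "0 \<notin> S" unfolding S_def by (auto dest: N_pos)
  next
    fix x assume "x \<in> S"
    then obtain B where B: "B \<subseteq> {..<r}" "B \<noteq> {}" "c * x = N B" by (auto simp: S_def)
    \<comment> \<open>\<open>rot\<close> divides by \<open>g\<close> modulo
      \<open>g ^ r - 1\<close>. Only exponent 0 wraps around, which adds
      \<open>g ^ r - 1 = m * c\<close>, that is, \<open>c\<close> times the digit
      \<open>m\<close>.\<close>
    define rot where "rot j = (if j = 0 then r - 1 else j - 1)" for j :: nat
    define l where "l = (if 0 \<in> B then int m else 0)"
    have "finite B" using B finite_subset by blast
    have "inj_on rot B" using B(1) by (fastforce simp: inj_on_def rot_def split: if_splits)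
    then have "int g * N (rot ` B) = (\<Sum>j\<in>B. int g ^ Suc (rot j))"
      by (simp add: N_def sum.reindex sum_distrib_left)
    also have "\<dots> = (\<Sum>j\<in>B. int g ^ j + (if j = 0 then int g ^ r - 1 else 0))"
      using \<open>r > 0\<close> by (intro sum.cong) (auto simp: rot_def simp flip: power_Suc)
    also have "\<dots> = c * (x + l)"
      using B(3) \<open>finite B\<close> by (simp add: sum.distrib N_def l_def distrib_left flip: m)
    finally have eq: "int g * N (rot ` B) = c * (x + l)" .
    then have "c dvd N (rot ` B)"
      using \<open>coprime c (int g)\<close> by (metis coprime_dvd_mult_right_iff dvd_triv_left)
    then obtain y where y: "c * y = N (rot ` B)" by (metis dvdE)
    have "rot ` B \<subseteq> {..<r}" using B(1) \<open>r > 0\<close> by (auto simp: rot_def)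
    then have "y \<in> S" using B(2) y by (auto simp: S_def)
    moreover have "c * (int g * y) = c * (x + l)" using eq unfolding y[symmetric] by (simp only: mult.left_commute)
    then have "int g * y - x = l" using \<open>c > 0\<close> by simp
    moreover have "l \<in> {0, int m}" by (simp add: l_def)
    ultimately show "\<exists>y\<in>S. int g * y - x \<in> {0, int m}" by metis
  qed (use assms in auto)
qed

lemma repunit_mult: "(g - 1) * (\<Sum>j<r. g ^ j) = g ^ r - 1" if "g > 0" for g :: nat
proof -
  have "int ((g - 1) * (\<Sum>j<r. g ^ j)) = int (g ^ r - 1)"
    using that by (simp add: of_nat_diff power_diff_1_eq Suc_le_eq)
  then show ?thesis by (rule of_nat_eq_iff[THEN iffD1])
qed

lemma repunit_incomplete:
  assumes "g > 1" and "r \<ge> g - 1"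
  shows "\<not> complete_number g (\<Sum>j<r. g ^ j)"
proof (rule incomplete_if_digit_set)
  show "int (\<Sum>j<r. g ^ j) * (int g - 1) = int g ^ r - 1"
    by (simp add: power_diff_1_eq mult.commute)
  show "{..<g - 1} \<noteq> {}" using assms by (auto simp: lessThan_empty_iff)
  \<comment> \<open>The numerator has \<open>g - 1\<close> terms, each congruent to 1, so it is
    congruent to \<open>g - 1\<close> and hence to 0.\<close>
  have "[int g = 1] (mod (int g - 1))" by (simp add: cong_iff_dvd_diff)
  then have "[(\<Sum>j<g - 1. int g ^ j) = (\<Sum>j<g - 1. 1 ^ j)] (mod (int g - 1))"
    by (intro cong_sum cong_pow)
  then have "[(\<Sum>j<g - 1. int g ^ j) = 0] (mod (int g - 1))"
    using assms by (simp add: of_nat_diff cong_def)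
  then show "int g - 1 dvd (\<Sum>j<g - 1. int g ^ j)" by (simp add: cong_0_iff)
qed (use assms in auto)

text \<open>Euler's theorem is applied modulo \<open>(g - 1) * d\<close> rather than
  \<open>d\<close>, since \<open>d\<close> may share factors with \<open>g - 1\<close>. The factor
  \<open>g\<close> in the factorial makes room for the totient of this modulus. The
  \<open>Suc\<close> turns \<open>g ^ t\<close> congruent to 1 into \<open>g ^ Suc t\<close>
  congruent to \<open>g\<close>, that is, \<open>(g - 1) * R\<close> congruent to
  \<open>g - 1\<close>.\<close>

lemma small_divisor_repunit:
  fixes g :: nat
  assumes "g > 1" and d: "d dvd (\<Sum>j<Suc (fact (g * M)). g ^ j)" and "d \<le> M"
  shows "d = 1"
proof -
  define t :: nat where "t = fact (g * M)"
  define R where "R = (\<Sum>j<Suc t. g ^ j)"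
  have mult: "(g - 1) * R = g ^ Suc t - 1" unfolding R_def using assms by (intro repunit_mult) simp
  have pos: "g ^ n > 0" for n using assms by simp
  have "R > 0" unfolding R_def using assms by (intro sum_pos) auto
  then have "d > 0" using d by (auto simp: R_def t_def intro!: Nat.gr0I)
  have "coprime g ((g - 1) * R)"
    unfolding mult using coprime_diff_one_right_nat[OF pos[of "Suc t"]] by simp
  then have "coprime g ((g - 1) * d)"
    using d by (auto simp: R_def t_def dest: coprime_divisors[OF dvd_refl])
  moreover have "totient ((g - 1) * d) dvd t"
  proof -
    have "totient ((g - 1) * d) \<le> (g - 1) * d" by (rule totient_le)
    also have "\<dots> \<le> g * M" using \<open>d \<le> M\<close> by (intro mult_le_mono) auto
    finally show ?thesis
      unfolding t_def using \<open>d > 0\<close> assms by (intro dvd_fact) (auto simp: Suc_le_eq)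
  qed
  ultimately have "[g ^ t = 1] (mod (g - 1) * d)"
    by (metis euler_theorem cong_pow dvdE power_mult power_one)
  then have "[g * g ^ t = g * 1] (mod (g - 1) * d)" by (rule cong_scalar_left)
  moreover have "g * g ^ t = (g - 1) * R + 1" using mult pos[of "Suc t"] by simp
  moreover have "g * 1 = (g - 1) * 1 + 1" using assms by simp
  ultimately have "[(g - 1) * R = (g - 1) * 1] (mod (g - 1) * d)"
    by (metis cong_add_rcancel_nat)
  \<comment> \<open>The positive factor \<open>g - 1\<close> cancels from both sides and from the
    modulus.\<close>
  then have "[R = 1] (mod d)"
    using assms by (simp add: cong_def mult_mod_right[symmetric] del: mult_1_right)
  then have "d dvd R \<longleftrightarrow> d dvd 1" by (rule cong_dvd_iff)
  then show ?thesis using d by (simp add: R_def t_def)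
qed

text \<open>Comparing the largest and the smallest point with their predecessors confines the cycle
  to 0. For \<open>g = 2\<close> this would fail: 1 is then fixed with digit 1.\<close>

lemma complete_1:
  assumes "g > 2"
  shows "complete_number g 1"
  unfolding complete_number_def
proof (intro conjI allI impI)
  fix xs ls assume c: "extreme_cycle g 1 xs ls"
  define n where "n = length xs"
  have n: "n > 0" "length ls = n" and "distinct xs" and ls: "set ls \<subseteq> {0, 1}"
    using c by (auto simp: extreme_cycle_def n_def)
  have nth_ls: "ls ! j \<in> {0, 1}" if "j < n" for j using ls n that nth_mem by blast
  \<comment> \<open>Indices modulo \<open>n\<close> merge the closing equation with the
    others.\<close>
  have step: "int g * xs ! ((j + 1) mod n) = xs ! j + ls ! j" if "j < n" for j
  proof -
    have "real_of_int (xs ! ((j + 1) mod n)) = real_of_int (xs ! j + ls ! j) / real g"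
    proof (cases "Suc j < n")
      case True
      then show ?thesis using c by (simp add: extreme_cycle_def n_def)
    next
      case False
      then have "j = n - 1" "(j + 1) mod n = 0" using that by (auto simp: not_less le_Suc_eq)
      then show ?thesis using c by (simp add: extreme_cycle_def n_def)
    qed
    then have "real_of_int (int g * xs ! ((j + 1) mod n)) = real_of_int (xs ! j + ls ! j)"
      using assms by (simp add: field_simps)
    then show ?thesis by linarith
  qed
  have pred: "\<exists>y\<in>set xs. int g * x - y \<in> {0, 1}" if "x \<in> set xs" for x
  proof -
    obtain k where k: "k < n" "x = xs ! k" using \<open>x \<in> set xs\<close> by (auto simp: in_set_conv_nth n_def)
    define j where "j = (if k = 0 then n - 1 else k - 1)"
    have "j < n" "(j + 1) mod n = k" using k by (auto simp: j_def)
    then show ?thesis using step[of j] nth_ls[of j] k by (intro bexI[of _ "xs ! j"]) (auto simp: n_def)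
  qed
  have fin: "finite (set xs)" "set xs \<noteq> {}" using n by (auto simp: n_def)
  obtain y where y: "y \<in> set xs" "int g * Max (set xs) \<le> y + 1"
    using pred[OF Max_in[OF fin]] by force
  then have "(int g - 1) * Max (set xs) \<le> 1"
    unfolding left_diff_distrib using y(2) Max_ge[OF fin(1) y(1)] by linarith
  also have "1 < (int g - 1) * 1" using assms by simp
  finally have Max: "Max (set xs) \<le> 0" using assms by (auto simp: mult_less_cancel_left simp del: mult_1_right)
  obtain z where z: "z \<in> set xs" "int g * Min (set xs) \<ge> z"
    using pred[OF Min_in[OF fin]] by force
  then have "(int g - 1) * Min (set xs) \<ge> 0"
    unfolding left_diff_distrib using z(2) Min_le[OF fin(1) z(1)] by linarith
  then have Min: "Min (set xs) \<ge> 0" using assms by (simp add: zero_le_mult_iff)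
  have zero: "x = 0" if "x \<in> set xs" for x
    using Max Min Max_ge[OF fin(1) that] Min_le[OF fin(1) that] by linarith
  then have "set xs \<subseteq> {0}" by blast
  then have "set xs = {0}" using fin(2) by (simp add: subset_singleton_iff)
  then have "length xs = 1" using distinct_card[OF \<open>distinct xs\<close>] by simp
  then obtain x where "xs = [x]" by (auto simp: length_Suc_conv)
  then show xs: "xs = [0]" using \<open>set xs = {0}\<close> by simp
  then have "length ls = 1" using n by (simp add: n_def)
  then obtain l where "ls = [l]" by (auto simp: length_Suc_conv)
  then show "ls = [0]" using xs step[of 0] by (simp add: n_def)
qed simp

lemma incomplete_has_primitive_divisor:
  assumes "incomplete_number g m"
  obtains d where "d dvd m" "primitive_number g d"
proof -
  define d where "d = (LEAST d. d dvd m \<and> incomplete_number g d)"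
  have d: "d dvd m" "incomplete_number g d"
    using LeastI[of "\<lambda>d. d dvd m \<and> incomplete_number g d" m] assms by (auto simp: d_def)
  have "complete_number g e" if "e dvd d" "e \<noteq> d" for e
  proof (rule ccontr)
    assume "\<not> complete_number g e"
    \<comment> \<open>Oddness passes to \<open>e\<close>, as \<open>incomplete_number\<close>
      demands, and makes \<open>d\<close> positive, so that \<open>e < d\<close>.\<close>
    moreover have "odd d" using d by (simp add: incomplete_number_def)
    then have "odd e" "e < d"
      using that by (auto intro: dvd_trans simp: odd_pos dvd_imp_le le_neq_implies_less)
    ultimately show False
      using not_less_Least[of e "\<lambda>d. d dvd m \<and> incomplete_number g d"] d that
      by (auto simp: d_def incomplete_number_def dest: dvd_trans)
  qed
  then show thesis using d that by (auto simp: primitive_number_def)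
qed

theorem theorem2p17:
  fixes g :: nat
  assumes "even g" and "g \<ge> 4"
  shows "infinite {m::nat. primitive_number g m}"
  unfolding infinite_nat_iff_unbounded
proof
  fix M
  \<comment> \<open>\<open>Suc M\<close> keeps the factorial at least \<open>g\<close> even for
    \<open>M = 0\<close>, which yields \<open>r \<ge> g - 1\<close>.\<close>
  define r :: nat where "r = Suc (fact (g * Suc M))"
  define R where "R = (\<Sum>j<r. g ^ j)"
  have "g \<le> g * Suc M" by simp
  also have "\<dots> \<le> fact (g * Suc M)" by (rule fact_ge_self)
  finally have "\<not> complete_number g R"
    unfolding R_def using assms by (intro repunit_incomplete) (auto simp: r_def)
  moreover have "odd R"
  proof -
    \<comment> \<open>All terms except the one with exponent 0 are multiples of the even number
      \<open>g\<close>.\<close>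
    have "R = 1 + (\<Sum>j<fact (g * Suc M). g * g ^ j)"
      unfolding R_def r_def by (subst sum.lessThan_Suc_shift) simp
    then show ?thesis using \<open>even g\<close> by (simp add: dvd_sum)
  qed
  ultimately obtain d where d: "d dvd R" "primitive_number g d"
    using incomplete_has_primitive_divisor by (metis incomplete_number_def)
  have "d \<noteq> 1"
    using d complete_1[of g] assms by (auto simp: primitive_number_def incomplete_number_def)
  then have "\<not> d \<le> Suc M"
    using small_divisor_repunit[of g d "Suc M"] d(1) assms by (auto simp: R_def r_def)
  then show "\<exists>n>M. n \<in> {m. primitive_number g m}" using d by (intro exI[of _ d]) auto
qed

end
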